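(* Let $\mathcal{H}$ be a separable complex Hilbert space and let $T,L\in\mathcal{B}(\mathcal{H})$ be invertible operators such that $LT=TL$. Consider the set $$\mathcal{V}:=\{v\in\mathcal{H}: (\mathcal{H},T,L,v)\text{ is a bilateral frame-tuple}\}.$$ Assume that $w\in\mathcal{V}$. Then, for $v\in\mathcal{H}$, one has $v\in\mathcal{V}$ if and only if $(\mathcal{H},T,L,v)$ is similar to $(\mathcal{H},T,L,w)$; i.e. $$\mathcal{V}=\{Bw: B\in\mathcal{B}(\mathcal{H}),\ B\text{ is invertible and commutes with }T\text{ and }L\}.$$
   Context: $\mathcal{B}(\mathcal{H})$ denotes the bounded linear operators on $\mathcal{H}$. For $v\in\mathcal{H}$ and commuting invertible $T,L\in\mathcal{B}(\mathcal{H})$, $(\mathcal{H},T,L,v)$ is a bilateral frame-tuple if $\{T^kL^jv: k,j\in\mathbb{Z}\}$ is a frame of $\mathcal{H}$. Two tuples $(\mathcal{H}_1,T_1,L_1,v_1)$ and $(\mathcal{H}_2,T_2,L_2,v_2)$ are similar if there is a bounded isomorphism (bounded linear bijection) $C:\mathcal{H}_1\to\mathcal{H}_2$ with $Cv_1=v_2$, $T_2C=CT_1$ and $L_2C=CL_1$. *)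

theory Defs
  imports "HOL-Analysis.Analysis"
begin

text \<open>
  Complex inner product spaces are real inner product spaces (with respect to the real part of
  the complex inner product) that carry in addition a complex scalar multiplication and a
  sesquilinear form. Norm and topology are the ones given by \<^class>\<open>real_inner\<close>; since
  \<open>\<langle>x, x\<rangle>\<close> is real by conjugate symmetry, they satisfy \<open>\<parallel>x\<parallel>\<^sup>2 = \<langle>x, x\<rangle>\<close>. The form is linear in
  the first and conjugate linear in the second argument.
\<close>

class complex_inner = real_inner +
  fixes scaleC :: "complex \<Rightarrow> 'a \<Rightarrow> 'a" (infixr \<open>*\<^sub>C\<close> 75)
    and cinner :: "'a \<Rightarrow> 'a \<Rightarrow> complex"
  assumes scaleC_add_right: "a *\<^sub>C (x + y) = a *\<^sub>C x + a *\<^sub>C y"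
    and scaleC_add_left: "(a + b) *\<^sub>C x = a *\<^sub>C x + b *\<^sub>C x"
    and scaleC_scaleC: "a *\<^sub>C b *\<^sub>C x = (a * b) *\<^sub>C x"
    and scaleR_eq_scaleC: "r *\<^sub>R x = complex_of_real r *\<^sub>C x"
    and cinner_add_left: "cinner (x + y) z = cinner x z + cinner y z"
    and cinner_scaleC_left: "cinner (a *\<^sub>C x) y = a * cinner x y"
    and cinner_commute: "cinner x y = cnj (cinner y x)"
    and inner_eq_Re_cinner: "inner x y = Re (cinner x y)"

class complex_hilbert_space = complex_inner + complete_space

instantiation complex :: complex_hilbert_space
begin

definition scaleC_complex :: "complex \<Rightarrow> complex \<Rightarrow> complex"
  where "scaleC_complex a x = a * x"

definition cinner_complex :: "complex \<Rightarrow> complex \<Rightarrow> complex"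
  where "cinner_complex x y = x * cnj y"

instance
  by standard
    (simp_all add: scaleC_complex_def cinner_complex_def algebra_simps inner_complex_def
      scaleR_conv_of_real)

end

lemma cinner_self: "cinner x x = complex_of_real ((norm x)\<^sup>2)" for x :: "'a::complex_inner"
proof -
  have "Im (cinner x x) = 0"
    using arg_cong[OF cinner_commute[of x x], of Im] by simp
  then show ?thesis
    by (simp add: complex_eq_iff power2_norm_eq_inner inner_eq_Re_cinner)
qed

definition bounded_clinear :: "('a::complex_inner \<Rightarrow> 'b::complex_inner) \<Rightarrow> bool"
  where "bounded_clinear A \<longleftrightarrow> bounded_linear A \<and> (\<forall>c x. A (c *\<^sub>C x) = c *\<^sub>C A x)"

text \<open>\<open>A\<close> is an invertible element of the algebra of bounded operators.\<close>

definition invertible_op :: "('a::complex_inner \<Rightarrow> 'a) \<Rightarrow> bool"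
  where "invertible_op A \<longleftrightarrow> bounded_clinear A \<and>
    (\<exists>S. bounded_clinear S \<and> S \<circ> A = id \<and> A \<circ> S = id)"

text \<open>Integer powers; meaningful for bijective \<open>A\<close>, where \<open>inv A\<close> is the two-sided inverse.\<close>

definition int_funpow :: "('a \<Rightarrow> 'a) \<Rightarrow> int \<Rightarrow> 'a \<Rightarrow> 'a"
  where "int_funpow A k = (if 0 \<le> k then A ^^ nat k else inv A ^^ nat (- k))"

text \<open>
  Frames are indexed families, so repeated vectors count with multiplicity. Summability is
  required explicitly because \<^const>\<open>infsum\<close> is 0 on families that are not summable.
\<close>

definition is_frame :: "('i \<Rightarrow> 'a::complex_inner) \<Rightarrow> bool"
  where "is_frame f \<longleftrightarrow> (\<exists>A B. 0 < A \<and> 0 < B \<and>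
    (\<forall>x. (\<lambda>i. (cmod (cinner x (f i)))\<^sup>2) summable_on UNIV \<and>
         A * (norm x)\<^sup>2 \<le> (\<Sum>\<^sub>\<infinity>i. (cmod (cinner x (f i)))\<^sup>2) \<and>
         (\<Sum>\<^sub>\<infinity>i. (cmod (cinner x (f i)))\<^sup>2) \<le> B * (norm x)\<^sup>2))"

text \<open>In the tuples below the Hilbert space is the underlying type of the operators.\<close>

definition bilateral_frame_tuple ::
    "('a::complex_hilbert_space \<Rightarrow> 'a) \<Rightarrow> ('a \<Rightarrow> 'a) \<Rightarrow> 'a \<Rightarrow> bool"
  where "bilateral_frame_tuple T L v \<longleftrightarrow>
    invertible_op T \<and> invertible_op L \<and> T \<circ> L = L \<circ> T \<and>
    is_frame (\<lambda>(k, j). int_funpow T k (int_funpow L j v))"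

definition frame_vectors ::
    "('a::complex_hilbert_space \<Rightarrow> 'a) \<Rightarrow> ('a \<Rightarrow> 'a) \<Rightarrow> 'a set"
  where "frame_vectors T L = {v. bilateral_frame_tuple T L v}"

definition similar_tuples ::
    "('a::complex_hilbert_space \<Rightarrow> 'a) \<Rightarrow> ('a \<Rightarrow> 'a) \<Rightarrow> 'a \<Rightarrow>
     ('b::complex_hilbert_space \<Rightarrow> 'b) \<Rightarrow> ('b \<Rightarrow> 'b) \<Rightarrow> 'b \<Rightarrow> bool"
  where "similar_tuples T1 L1 v1 T2 L2 v2 \<longleftrightarrow>
    (\<exists>C. bounded_clinear C \<and> bij C \<and> C v1 = v2 \<and> T2 \<circ> C = C \<circ> T1 \<and> L2 \<circ> C = C \<circ> L1)"

end

theory Submission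
  imports Defs
begin

text \<open>
  Write \<open>\<pi>(g) = T\<^sup>k L\<^sup>j\<close> for \<open>g = (k, j)\<close>, and let \<open>\<Theta>\<^sub>w x = (\<langle>x, \<pi>(g) w\<rangle>)\<^sub>g\<close> be the analysis operator of
  the orbit of \<open>w\<close>. If \<open>v\<close> and \<open>w\<close> both generate frames, the candidate for an operator that sends
  \<open>w\<close> to \<open>v\<close> is forced: its adjoint \<open>C\<close> has to satisfy \<open>\<Theta>\<^sub>w C = \<Theta>\<^sub>v\<close>. Such a \<open>C\<close> exists, and is
  then automatically bounded and compatible with \<open>\<pi>\<close>, as soon as the range of \<open>\<Theta>\<^sub>v\<close> is contained in
  that of \<open>\<Theta>\<^sub>w\<close>. So the heart of the matter is that all generators have the same range of
  coefficient families.

  These ranges are closed subspaces of \<open>\<ell>\<^sup>2\<close> invariant under translations. They are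
  images of isomorphic representations, and translation-invariant operators on an abelian group
  commute with each other, which forces isomorphic invariant subspaces to coincide. In the
  Fourier picture an invariant subspace consists of the functions that vanish outside some set of
  characters, and an isomorphism cannot change that set. The proof here uses only convolution
  kernels. The projection onto the range of \<open>\<Theta>\<^sub>w\<close> is convolution by a kernel \<open>\<phi>\<close> with
  \<open>\<phi>(- g) = cnj (\<phi> g)\<close>; as the group is abelian, this makes the range invariant under
  the reflection \<open>c\<^sub>g \<mapsto> cnj c\<^sub>-\<^sub>g\<close> (\<open>range_analysis_op_reflect\<close>). Now let \<open>S\<^sub>v = \<Theta>\<^sub>v\<^sup>* \<Theta>\<^sub>v\<close>
  be the frame operator. Equivariance of the dual frame shows that \<open>\<Theta>\<^sub>v S\<^sub>v\<^sup>-\<^sup>1 \<pi>(g) w\<close> is the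
  reflection of \<open>\<Theta>\<^sub>w S\<^sub>v\<^sup>-\<^sup>1 \<pi>(- g) v\<close>, so it belongs to both ranges. Since the vectors \<open>\<pi>(g) w\<close>
  are total, these families are total in the range of \<open>\<Theta>\<^sub>v\<close>, which is therefore contained in the
  range of \<open>\<Theta>\<^sub>w\<close> (\<open>orthogonal_complement_mono\<close>, \<open>range_analysis_op_subset\<close>).

  Conversely an invertible operator in the commutant maps the frame of \<open>w\<close> to a frame
  (\<open>is_frame_invertible_op\<close>). A similarity is only required to be a bounded bijection, so Banach's
  inverse theorem is needed to see that it is invertible in this sense (\<open>bounded_linear_inv\<close>).
\<close>

section \<open>Representation of functionals, adjoints and inverses\<close>

text \<open>
  The Lax--Milgram lemma for symmetric forms, which serves both as the Riesz representation
  theorem (for the inner product) and to invert frame operators (for the form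
  \<open>\<langle>\<Theta> x, \<Theta> y\<rangle>\<close> of a frame with analysis operator \<open>\<Theta>\<close>). The representing vector is the minimiser
  of \<open>Q x x - 2 \<phi> x\<close>: minimising sequences are Cauchy by the parallelogram law, and the
  derivative at the minimum vanishes.
\<close>

lemma symmetric_form_representation:
  fixes Q :: "'a::{real_inner, complete_space} \<Rightarrow> 'a \<Rightarrow> real"
  assumes Q: "bounded_bilinear Q" and sym: "\<And>x y. Q x y = Q y x"
    and "0 < \<alpha>" and coercive: "\<And>x. \<alpha> * (norm x)\<^sup>2 \<le> Q x x"
    and \<phi>: "bounded_linear \<phi>"
  shows "\<exists>z. \<forall>x. Q x z = \<phi> x"
proof -
  interpret Q: bounded_bilinear Q by (rule Q)
  interpret \<phi>: bounded_linear \<phi> by (rule \<phi>)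
  define J where "J x = Q x x - 2 * \<phi> x" for x
  obtain K where K: "norm (\<phi> x) \<le> norm x * K" for x
    using \<phi>.bounded by blast
  \<comment> \<open>Complete the square in \<open>norm x\<close>.\<close>
  have "- (K\<^sup>2 / \<alpha>) \<le> J x" for x
  proof -
    have "0 \<le> (\<alpha> * norm x - K)\<^sup>2 / \<alpha>"
      using \<open>0 < \<alpha>\<close> by simp
    also have "\<dots> = \<alpha> * (norm x)\<^sup>2 - 2 * (norm x * K) + K\<^sup>2 / \<alpha>"
      using \<open>0 < \<alpha>\<close> by (simp add: power2_eq_square field_simps)
    also have "\<dots> \<le> J x + K\<^sup>2 / \<alpha>"
      using coercive[of x] K[of x] by (simp add: J_def)
    finally show ?thesis by simp
  qed
  then have bdd: "bdd_below (range J)"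
    by (meson bdd_belowI2)
  define m where "m = Inf (range J)"
  have m_le: "m \<le> J x" for x
    unfolding m_def using bdd by (rule cInf_lower[OF rangeI])
  have "\<exists>x. J x < m + inverse (real (Suc n))" for n
    using cInf_lessD[of "range J" "m + inverse (real (Suc n))"] unfolding m_def by auto
  then obtain X where X: "J (X n) < m + inverse (real (Suc n))" for n
    by metis
  have parallelogram: "Q (x - y) (x - y) = 2 * J x + 2 * J y - 4 * J ((1/2) *\<^sub>R (x + y))" for x y
    by (simp add: J_def Q.diff_left Q.diff_right Q.add_left Q.add_right Q.scaleR_left
        Q.scaleR_right \<phi>.add \<phi>.scaleR algebra_simps)
  have close: "\<alpha> * (norm (X k - X n))\<^sup>2 \<le> 2 * inverse (real (Suc k)) + 2 * inverse (real (Suc n))"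
    for k n
    using coercive[of "X k - X n"] parallelogram[of "X k" "X n"] X[of k] X[of n]
      m_le[of "(1/2) *\<^sub>R (X k + X n)"] by linarith
  have "Cauchy X"
  proof (rule CauchyI)
    fix e :: real assume "0 < e"
    then have "0 < \<alpha> * e\<^sup>2 / 4" using \<open>0 < \<alpha>\<close> by simp
    then obtain N where N: "inverse (real (Suc N)) < \<alpha> * e\<^sup>2 / 4"
      using reals_Archimedean by blast
    have "norm (X k - X n) < e" if "N \<le> k" "N \<le> n" for k n
    proof -
      have "inverse (real (Suc k)) \<le> inverse (real (Suc N))"
        "inverse (real (Suc n)) \<le> inverse (real (Suc N))"
        using that by (auto intro!: le_imp_inverse_le)
      with close[of k n] N have "\<alpha> * (norm (X k - X n))\<^sup>2 < \<alpha> * e\<^sup>2" by linarith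
      then have "(norm (X k - X n))\<^sup>2 < e\<^sup>2" using \<open>0 < \<alpha>\<close> by simp
      then show ?thesis using \<open>0 < e\<close> power_less_imp_less_base by fastforce
    qed
    then show "\<exists>M. \<forall>k\<ge>M. \<forall>n\<ge>M. norm (X k - X n) < e" by blast
  qed
  then obtain z where z: "X \<longlonglongrightarrow> z"
    by (meson Cauchy_convergent convergent_def)
  have "(\<lambda>n. J (X n)) \<longlonglongrightarrow> J z"
    unfolding J_def by (intro tendsto_intros Q.tendsto \<phi>.tendsto z)
  moreover have "(\<lambda>n. m + inverse (real (Suc n))) \<longlonglongrightarrow> m + 0"
    by (intro tendsto_intros LIMSEQ_inverse_real_of_nat)
  ultimately have "J z \<le> m + 0"
    by (rule LIMSEQ_le) (use X in \<open>auto intro: less_imp_le\<close>)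
  then have min: "J z \<le> J x" for x
    using m_le[of x] by simp
  have "Q x z = \<phi> x" for x
  proof -
    define a where "a = Q x z - \<phi> x"
    have *: "0 \<le> 2 * t * a + t\<^sup>2 * Q x x" for t
      using min[of "z + t *\<^sub>R x"] unfolding a_def J_def
      by (simp add: Q.add_left Q.add_right Q.scaleR_left Q.scaleR_right \<phi>.add \<phi>.scaleR
          sym[of z x] power2_eq_square algebra_simps)
    have "0 \<le> Q x x"
      using coercive[of x] \<open>0 < \<alpha>\<close> by (meson mult_nonneg_nonneg less_imp_le order_trans zero_le_power2)
    \<comment> \<open>The step \<open>t = - a / s\<close> makes the linear term win over the quadratic one as soon as
      \<open>2 s > Q x x\<close>; adding 1 keeps \<open>s\<close> positive.\<close>
    define s where "s = Q x x + 1"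
    have "s > 0" "Q x x < 2 * s" using \<open>0 \<le> Q x x\<close> by (auto simp: s_def)
    have "0 \<le> 2 * (- (a / s)) * a + (- (a / s))\<^sup>2 * Q x x" by (rule *)
    also have "\<dots> = - ((a / s)\<^sup>2 * (2 * s - Q x x))"
      using \<open>s > 0\<close> by (simp add: power2_eq_square field_simps)
    finally have "(a / s)\<^sup>2 * (2 * s - Q x x) \<le> 0" by simp
    then have "a / s = 0"
      using \<open>Q x x < 2 * s\<close> by (simp add: mult_le_0_iff)
    then show ?thesis using \<open>s > 0\<close> by (simp add: a_def)
  qed
  then show ?thesis by blast
qed

lemma inner_adjoint:
  fixes A :: "'a::{real_inner, complete_space} \<Rightarrow> 'b::real_inner"
  assumes "bounded_linear A"
  shows "inner (A x) y = inner x (adjoint A y)"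
proof -
  have "\<exists>z. \<forall>x. inner x z = inner (A x) y" for y
  proof (rule symmetric_form_representation[where Q = inner and \<alpha> = 1])
    show "bounded_linear (\<lambda>x. inner (A x) y)"
      using bounded_linear_compose[OF bounded_linear_inner_left assms] .
  qed (simp_all add: bounded_bilinear_inner inner_commute power2_norm_eq_inner)
  then have "\<exists>A'. \<forall>x y. inner (A x) y = inner x (A' y)"
    by metis
  then show ?thesis
    unfolding adjoint_def by (rule someI2_ex) blast
qed

lemma bounded_linear_adjoint:
  fixes A :: "'a::{real_inner, complete_space} \<Rightarrow> 'b::real_inner"
  assumes A: "bounded_linear A"
  shows "bounded_linear (adjoint A)"
proof -
  obtain K where K: "norm (A x) \<le> norm x * K" "0 \<le> K" for x
    using bounded_linear.nonneg_bounded[OF A] by blast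
  note [simp] = inner_adjoint[OF A, symmetric]
  show ?thesis
  proof (rule bounded_linear_intro[where K = K])
    fix x y r
    show "adjoint A (x + y) = adjoint A x + adjoint A y"
      by (rule vector_eq_ldot[THEN iffD1]) (simp add: inner_add_right)
    show "adjoint A (r *\<^sub>R x) = r *\<^sub>R adjoint A x"
      by (rule vector_eq_ldot[THEN iffD1]) simp
    have "(norm (adjoint A x))\<^sup>2 = inner (A (adjoint A x)) x"
      by (simp add: power2_norm_eq_inner)
    also have "\<dots> \<le> norm (A (adjoint A x)) * norm x"
      by (rule norm_cauchy_schwarz)
    also have "\<dots> \<le> (norm (adjoint A x) * K) * norm x"
      by (intro mult_right_mono K) simp
    finally have "norm (adjoint A x) * norm (adjoint A x) \<le> norm (adjoint A x) * (norm x * K)"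
      by (simp add: power2_eq_square ac_simps)
    then show "norm (adjoint A x) \<le> norm x * K"
      using K(2) by (cases "norm (adjoint A x) = 0") (auto simp: mult_le_cancel_left)
  qed
qed

text \<open>
  The uniform boundedness principle for vectors seen as functionals: by Baire's theorem some set
  \<open>F n\<close> of points where the family is bounded by \<open>n\<close> contains a ball, and differences of points of
  that ball reach every direction.
\<close>

lemma weakly_bounded_imp_bounded:
  fixes E :: "'a::{real_inner, complete_space} set"
  assumes weak: "\<And>y. \<exists>K. \<forall>x\<in>E. \<bar>inner x y\<bar> \<le> K"
  shows "\<exists>K. \<forall>x\<in>E. norm x \<le> K"
proof -
  define F where "F n = {y. \<forall>x\<in>E. \<bar>inner x y\<bar> \<le> real n}" for n :: nat
  have closed: "closed (F n)" for n
  proof -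
    have "F n = (\<Inter>x\<in>E. {y. \<bar>inner x y\<bar> \<le> real n})" by (auto simp: F_def)
    then show ?thesis
      by (auto intro!: closed_INT closed_Collect_le continuous_intros)
  qed
  have "\<exists>n. y \<in> F n" for y
  proof -
    obtain K where "\<forall>x\<in>E. \<bar>inner x y\<bar> \<le> K" using weak by blast
    moreover obtain n where "K \<le> real n" using real_arch_simple by blast
    ultimately show ?thesis unfolding F_def by (auto intro: order_trans)
  qed
  then have "(\<Union>n. F n) = UNIV" by auto
  moreover have "interior (\<Union>n. F n) = {}" if "\<And>n. interior (F n) = {}"
    using Met_TC.metric_Baire_category_alt[of "range F"] closed that complete_UNIV
    by (auto simp: interior_of_eq interior_def)
  ultimately obtain n where "interior (F n) \<noteq> {}" by auto
  then obtain y r where r: "0 < r" "cball y r \<subseteq> F n"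
    by (metis ex_in_conv mem_interior_cball)
  have "norm x \<le> 2 * real n / r" if "x \<in> E" for x
  proof (cases "x = 0")
    case True then show ?thesis using r by simp
  next
    case False
    define u where "u = (r / norm x) *\<^sub>R x"
    have "norm u = r" using False r by (simp add: u_def)
    then have "y + u \<in> F n" "y \<in> F n"
      using r by (auto simp: subset_iff dist_norm)
    then have "\<bar>inner x (y + u)\<bar> \<le> real n" "\<bar>inner x y\<bar> \<le> real n"
      using that by (auto simp: F_def)
    moreover have "inner x u = r * norm x"
      using False by (simp add: u_def power2_norm_eq_inner[symmetric] power2_eq_square)
    ultimately have "r * norm x \<le> 2 * real n" by (simp add: inner_add_right)
    then show ?thesis using r by (simp add: field_simps)
  qed
  then show ?thesis by blast
qed

text \<open>
  Banach's inverse theorem. In a Hilbert space it reduces to uniform boundedness: the vectors with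
  \<open>norm (A' x) \<le> 1\<close> for the adjoint \<open>A'\<close> are weakly bounded because \<open>A\<close> is onto, so \<open>A'\<close> is bounded
  below. The coercive form \<open>\<langle>A' x, A' y\<rangle>\<close> then shows that every \<open>u\<close> is some \<open>A' z\<close>, and
  \<open>\<langle>u, u\<rangle> = \<langle>z, A u\<rangle>\<close> turns the lower bound of \<open>A'\<close> into one of \<open>A\<close>.
\<close>

lemma bounded_linear_inv:
  fixes A :: "'a::{real_inner, complete_space} \<Rightarrow> 'b::{real_inner, complete_space}"
  assumes A: "bounded_linear A" and bij: "bij A"
  shows "bounded_linear (inv A)"
proof -
  let ?A' = "adjoint A"
  interpret A: bounded_linear A by (rule A)
  interpret A': bounded_linear ?A' by (rule bounded_linear_adjoint[OF A])
  have adj: "inner (?A' x) u = inner x (A u)" for x u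
    using inner_adjoint[OF A, of u x] by (simp add: inner_commute)
  have "\<exists>K. \<forall>x\<in>{x. norm (?A' x) \<le> 1}. norm x \<le> K"
  proof (rule weakly_bounded_imp_bounded)
    fix y
    obtain u where "y = A u" using bij by (metis bij_pointE)
    have "\<bar>inner x y\<bar> \<le> norm u" if "norm (?A' x) \<le> 1" for x
    proof -
      have "\<bar>inner x y\<bar> \<le> norm (?A' x) * norm u"
        using Cauchy_Schwarz_ineq2[of "?A' x" u] by (simp add: adj \<open>y = A u\<close>)
      also have "\<dots> \<le> norm u"
        using that by (simp add: mult_left_le_one_le)
      finally show ?thesis .
    qed
    then show "\<exists>K. \<forall>x\<in>{x. norm (?A' x) \<le> 1}. \<bar>inner x y\<bar> \<le> K" by blast
  qed
  then obtain K0 where K0: "norm x \<le> K0" if "norm (?A' x) \<le> 1" for x by auto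
  define K where "K = max K0 1"
  have "0 < K" by (simp add: K_def)
  have K: "norm x \<le> K * norm (?A' x)" for x
  proof (cases "?A' x = 0")
    case False
    have "norm (?A' ((1 / norm (?A' x)) *\<^sub>R x)) \<le> 1" using False by (simp add: A'.scaleR)
    from K0[OF this] have "norm x / norm (?A' x) \<le> K" by (simp add: K_def)
    then show ?thesis using False by (simp add: field_simps)
  next
    case True
    have "x = 0"
    proof -
      obtain u where "x = A u" using bij by (metis bij_pointE)
      then have "inner x x = 0" using adj[of x u] True by simp
      then show ?thesis by simp
    qed
    then show ?thesis by (simp add: A'.zero)
  qed
  have bound: "norm u \<le> norm (A u) * K" for u
  proof -
    have "\<exists>z. \<forall>x. inner (?A' x) (?A' z) = inner x (A u)"
    proof (rule symmetric_form_representation[where \<alpha> = "1 / K\<^sup>2"])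
      show "bounded_bilinear (\<lambda>x y. inner (?A' x) (?A' y))"
        by (rule bounded_bilinear.comp[OF bounded_bilinear_inner]) (rule A'.bounded_linear)+
      show "1 / K\<^sup>2 * (norm x)\<^sup>2 \<le> inner (?A' x) (?A' x)" for x
        using power_mono[OF K[of x], of 2] \<open>0 < K\<close>
        by (simp add: power_mult_distrib power2_norm_eq_inner[of "?A' x", symmetric] field_simps)
    qed (use \<open>0 < K\<close> in \<open>auto simp: inner_commute bounded_linear_inner_left\<close>)
    then obtain z where z: "inner (?A' x) (?A' z) = inner x (A u)" for x by blast
    have "A (?A' z) = A u"
      by (rule vector_eq_ldot[THEN iffD1]) (simp add: z flip: adj)
    then have u: "u = ?A' z" using bij by (metis bij_pointE)
    have "(norm u)\<^sup>2 = inner z (A u)" using adj[of z u] by (simp add: power2_norm_eq_inner u)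
    also have "\<dots> \<le> norm z * norm (A u)" by (rule norm_cauchy_schwarz)
    also have "\<dots> \<le> (K * norm u) * norm (A u)"
      using K[of z] by (intro mult_right_mono) (simp_all add: u)
    finally have "norm u * norm u \<le> norm u * (norm (A u) * K)"
      by (simp add: power2_eq_square ac_simps)
    then show ?thesis using \<open>0 < K\<close>
      by (cases "norm u = 0") (auto simp: mult_le_cancel_left)
  qed
  have inv: "A (inv A y) = y" "inv A (A x) = x" for x y
    using bij by (simp_all add: bij_is_surj surj_f_inv_f bij_is_inj)
  show ?thesis
  proof (rule bounded_linear_intro[where K = K])
    show "inv A (x + y) = inv A x + inv A y" for x y
      by (metis A.add inv)
    show "inv A (r *\<^sub>R x) = r *\<^sub>R inv A x" for r x
      by (metis A.scaleR inv)
    show "norm (inv A y) \<le> norm y * K" for y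
      using bound[of "inv A y"] by (simp add: inv)
  qed
qed


section \<open>Complex inner products and adjoints\<close>

lemma cinner_eqI:
  fixes x y :: "'a::complex_inner"
  assumes "\<And>u. cinner u x = cinner u y"
  shows "x = y"
  by (rule vector_eq_ldot[THEN iffD1]) (simp add: inner_eq_Re_cinner assms)

lemma cinner_zero_left [simp]: "cinner 0 y = 0" for y :: "'a::complex_inner"
  using cinner_add_left[of 0 0 y] by simp

lemma cinner_minus_left: "cinner (- x) y = - cinner x y" for x :: "'a::complex_inner"
  using cinner_add_left[of x "- x" y] by (simp add: eq_neg_iff_add_eq_0 add.commute)

lemma cinner_diff_left: "cinner (x - y) z = cinner x z - cinner y z" for x :: "'a::complex_inner"
  using cinner_add_left[of x "- y" z] by (simp add: cinner_minus_left)

lemma cinner_scaleR_left: "cinner (r *\<^sub>R x) y = r *\<^sub>R cinner x y" for x :: "'a::complex_inner"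
  by (simp add: scaleR_eq_scaleC[of r x] cinner_scaleC_left scaleR_conv_of_real)

text \<open>
  Through this identity, statements about the complex form follow from their real parts applied
  to \<open>x\<close> and to \<open>\<i> x\<close>.
\<close>

lemma Im_cinner: "Im (cinner x y) = - Re (cinner (\<i> *\<^sub>C x) y)" for x :: "'a::complex_inner"
  by (simp add: cinner_scaleC_left)

lemma norm_scaleC_ii: "norm (\<i> *\<^sub>C x) = norm x" for x :: "'a::complex_inner"
proof -
  have "cinner (\<i> *\<^sub>C x) (\<i> *\<^sub>C x) = \<i> * cnj (\<i> * cinner x x)"
    by (subst cinner_scaleC_left, subst cinner_commute) (simp add: cinner_scaleC_left)
  then have "complex_of_real ((norm (\<i> *\<^sub>C x))\<^sup>2) = complex_of_real ((norm x)\<^sup>2)"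
    unfolding cinner_self by simp
  then show ?thesis
    by (simp only: of_real_eq_iff power2_eq_iff_nonneg norm_ge_zero)
qed

lemma cinner_adjoint:
  fixes A :: "'a::complex_hilbert_space \<Rightarrow> 'b::complex_inner"
  assumes "bounded_clinear A"
  shows "cinner (A x) y = cinner x (adjoint A y)"
proof -
  have A: "bounded_linear A" and "A (c *\<^sub>C x) = c *\<^sub>C A x" for c
    using assms by (auto simp: bounded_clinear_def)
  with inner_adjoint[OF A, of x y] inner_adjoint[OF A, of "\<i> *\<^sub>C x" y] show ?thesis
    by (simp add: complex_eq_iff Im_cinner inner_eq_Re_cinner)
qed

lemma cinner_adjoint':
  fixes A :: "'a::complex_hilbert_space \<Rightarrow> 'b::complex_inner"
  assumes "bounded_clinear A"
  shows "cinner (adjoint A y) x = cinner y (A x)"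
  by (metis assms cinner_adjoint cinner_commute)

lemma bounded_clinear_adjoint:
  fixes A :: "'a::complex_hilbert_space \<Rightarrow> 'b::complex_inner"
  assumes A: "bounded_clinear A"
  shows "bounded_clinear (adjoint A)"
proof -
  have "adjoint A (c *\<^sub>C x) = c *\<^sub>C adjoint A x" for c x
  proof (rule cinner_eqI)
    fix u
    show "cinner u (adjoint A (c *\<^sub>C x)) = cinner u (c *\<^sub>C adjoint A x)"
      by (metis A cinner_adjoint' cinner_commute cinner_scaleC_left)
  qed
  then show ?thesis
    using A bounded_linear_adjoint by (auto simp: bounded_clinear_def)
qed

section \<open>Square summable families\<close>

text \<open>
  Square summable families are kept as plain functions rather than forming a Hilbert space of their
  own: every vector that the proof constructs is found in the underlying space of the frame.
\<close>

definition ell2 :: "('i \<Rightarrow> complex) set"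
  where "ell2 = {c. (\<lambda>i. (cmod (c i))\<^sup>2) summable_on UNIV}"

definition ell2_norm_sq :: "('i \<Rightarrow> complex) \<Rightarrow> real"
  where "ell2_norm_sq c = (\<Sum>\<^sub>\<infinity>i. (cmod (c i))\<^sup>2)"

definition ell2_inner :: "('i \<Rightarrow> complex) \<Rightarrow> ('i \<Rightarrow> complex) \<Rightarrow> complex"
  where "ell2_inner c d = (\<Sum>\<^sub>\<infinity>i. c i * cnj (d i))"

definition analysis_op :: "('i \<Rightarrow> 'a::complex_inner) \<Rightarrow> 'a \<Rightarrow> 'i \<Rightarrow> complex"
  where "analysis_op f x = (\<lambda>i. cinner x (f i))"

lemma weighted_am_gm: "cmod (a * cnj b) \<le> (s / 2) * (cmod a)\<^sup>2 + (1 / (2 * s)) * (cmod b)\<^sup>2"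
  if "0 < s"
proof -
  have "0 \<le> (s * cmod a - cmod b)\<^sup>2 / (2 * s)" using that by simp
  also have "\<dots> = (s / 2) * (cmod a)\<^sup>2 + (1 / (2 * s)) * (cmod b)\<^sup>2 - cmod a * cmod b"
    using that by (simp add: power2_eq_square field_simps)
  finally show ?thesis by (simp add: norm_mult)
qed

lemma ell2_inner_abs_summable:
  assumes "c \<in> ell2" "d \<in> ell2"
  shows "(\<lambda>i. norm (c i * cnj (d i))) summable_on UNIV"
proof (rule Infinite_Sum.abs_summable_on_comparison_test')
  show "(\<lambda>i. (1 / 2) * (cmod (c i))\<^sup>2 + (1 / (2 * 1)) * (cmod (d i))\<^sup>2) summable_on UNIV"
    using assms unfolding ell2_def mem_Collect_eq
    by (intro summable_on_add summable_on_cmult_right)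
  show "norm (c i * cnj (d i)) \<le> (1 / 2) * (cmod (c i))\<^sup>2 + (1 / (2 * 1)) * (cmod (d i))\<^sup>2" for i
    by (rule weighted_am_gm) simp
qed

lemmas ell2_inner_summable = ell2_inner_abs_summable[THEN Infinite_Sum.abs_summable_summable]

lemma ell2_inner_bound:
  assumes c: "c \<in> ell2" and d: "d \<in> ell2" and "0 < s"
  shows "cmod (ell2_inner c d) \<le> (s / 2) * ell2_norm_sq c + (1 / (2 * s)) * ell2_norm_sq d"
proof -
  have sum: "(\<lambda>i. (s / 2) * (cmod (c i))\<^sup>2) summable_on UNIV"
    "(\<lambda>i. (1 / (2 * s)) * (cmod (d i))\<^sup>2) summable_on UNIV"
    using c d unfolding ell2_def mem_Collect_eq by (auto simp del: times_divide_eq_left intro!: summable_on_cmult_right)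
  have "cmod (ell2_inner c d) \<le> (\<Sum>\<^sub>\<infinity>i. norm (c i * cnj (d i)))"
    unfolding ell2_inner_def
    by (rule norm_infsum_bound[OF ell2_inner_abs_summable[OF c d]])
  also have "\<dots> \<le> (\<Sum>\<^sub>\<infinity>i. (s / 2) * (cmod (c i))\<^sup>2 + (1 / (2 * s)) * (cmod (d i))\<^sup>2)"
    by (intro infsum_mono ell2_inner_abs_summable[OF c d] summable_on_add sum weighted_am_gm
        \<open>0 < s\<close>)
  also have "\<dots> = (s / 2) * ell2_norm_sq c + (1 / (2 * s)) * ell2_norm_sq d"
    unfolding ell2_norm_sq_def by (simp only: infsum_add[OF sum] infsum_cmult_right')
  finally show ?thesis .
qed

lemma ell2_norm_sq_nonneg: "0 \<le> ell2_norm_sq c"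
  unfolding ell2_norm_sq_def by (intro infsum_nonneg) simp

text \<open>
  Cauchy--Schwarz, with upper bounds \<open>a\<close> and \<open>b\<close> in place of the two norms so that the frame
  bounds can be inserted directly. The weight \<open>b / a\<close> in the arithmetic-geometric mean bound gives
  the product; a perturbation by \<open>\<delta>\<close> keeps the weight meaningful when a bound is 0.
\<close>

lemma ell2_Cauchy_Schwarz:
  assumes c: "c \<in> ell2" and d: "d \<in> ell2"
    and a: "ell2_norm_sq c \<le> a\<^sup>2" and b: "ell2_norm_sq d \<le> b\<^sup>2" and nn: "0 \<le> a" "0 \<le> b"
  shows "cmod (ell2_inner c d) \<le> a * b"
proof (rule field_le_epsilon)
  fix e :: real assume "0 < e"
  define \<delta> where "\<delta> = min 1 (e / (a + b + 1))"
  have "0 < \<delta>" using nn \<open>0 < e\<close> by (simp add: \<delta>_def)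
  define a' b' where "a' = a + \<delta>" and "b' = b + \<delta>"
  have pos: "0 < a'" "0 < b'" using nn \<open>0 < \<delta>\<close> by (auto simp: a'_def b'_def)
  have le: "ell2_norm_sq c \<le> a'\<^sup>2" "ell2_norm_sq d \<le> b'\<^sup>2"
    using a b power_mono[of a a' 2] power_mono[of b b' 2] nn \<open>0 < \<delta>\<close>
    by (auto simp: a'_def b'_def intro: order_trans)
  have "cmod (ell2_inner c d) \<le>
      (b' / a' / 2) * ell2_norm_sq c + (1 / (2 * (b' / a'))) * ell2_norm_sq d"
    by (rule ell2_inner_bound[OF c d]) (use pos in simp)
  also have "\<dots> \<le> (b' / a' / 2) * a'\<^sup>2 + (1 / (2 * (b' / a'))) * b'\<^sup>2"
    using pos le by (intro add_mono mult_left_mono) auto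
  also have "\<dots> = a' * b'"
    using pos by (simp add: power2_eq_square field_simps)
  also have "\<dots> = a * b + \<delta> * (a + b + \<delta>)" by (simp add: a'_def b'_def algebra_simps)
  also have "\<delta> * (a + b + \<delta>) \<le> (e / (a + b + 1)) * (a + b + 1)"
    using nn \<open>0 < e\<close> \<open>0 < \<delta>\<close> by (intro mult_mono) (auto simp: \<delta>_def)
  finally show "cmod (ell2_inner c d) \<le> a * b + e" using nn \<open>0 < e\<close> by simp
qed

lemma ell2_inner_commute: "ell2_inner c d = cnj (ell2_inner d c)"
  unfolding ell2_inner_def by (subst infsum_cnj[symmetric]) (simp add: mult.commute)

lemma ell2_inner_add_left:
  assumes "c \<in> ell2" "c' \<in> ell2" "d \<in> ell2"
  shows "ell2_inner (\<lambda>i. c i + c' i) d = ell2_inner c d + ell2_inner c' d"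
  unfolding ell2_inner_def
  by (subst infsum_add[symmetric]) (use assms in \<open>auto simp: ell2_inner_summable distrib_right\<close>)

lemma ell2_inner_scale_left: "ell2_inner (\<lambda>i. a * c i) d = a * ell2_inner c d"
  unfolding ell2_inner_def by (simp add: mult.assoc infsum_cmult_right')

lemma ell2_inner_diff_right:
  assumes "c \<in> ell2" "d \<in> ell2" "d' \<in> ell2"
  shows "ell2_inner c (\<lambda>i. d i - d' i) = ell2_inner c d - ell2_inner c d'"
  unfolding ell2_inner_def
  using infsum_add[OF ell2_inner_summable[OF assms(1,2)]
      summable_on_uminus[THEN iffD2, OF ell2_inner_summable[OF assms(1,3)]]]
  by (simp add: infsum_uminus right_diff_distrib)

lemma ell2_inner_self: "c \<in> ell2 \<Longrightarrow> ell2_inner c c = complex_of_real (ell2_norm_sq c)"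
  using has_sum_of_real[OF has_sum_infsum, of "\<lambda>i. (cmod (c i))\<^sup>2" UNIV, where 'a = complex]
  unfolding ell2_inner_def ell2_norm_sq_def ell2_def
  by (intro infsumI) (simp add: complex_norm_square del: of_real_power flip: of_real_power)

lemma ell2_norm_sq_eq_0D: "c \<in> ell2 \<Longrightarrow> ell2_norm_sq c = 0 \<Longrightarrow> c i = 0"
  using nonneg_infsum_le_0D[of "\<lambda>i. (cmod (c i))\<^sup>2" UNIV i]
  by (simp add: ell2_norm_sq_def ell2_def)

lemma ell2_diff:
  assumes "c \<in> ell2" "d \<in> ell2"
  shows "(\<lambda>i. c i - d i) \<in> ell2"
proof -
  have "(\<lambda>i. norm ((cmod (c i - d i))\<^sup>2)) summable_on UNIV"
  proof (rule Infinite_Sum.abs_summable_on_comparison_test')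
    show "(\<lambda>i. 2 * (cmod (c i))\<^sup>2 + 2 * (cmod (d i))\<^sup>2) summable_on UNIV"
      using assms unfolding ell2_def mem_Collect_eq
      by (intro summable_on_add summable_on_cmult_right)
    fix i
    have "(cmod (c i - d i))\<^sup>2 \<le> (cmod (c i) + cmod (d i))\<^sup>2"
      by (intro power_mono norm_triangle_ineq4) simp
    also have "\<dots> \<le> 2 * (cmod (c i))\<^sup>2 + 2 * (cmod (d i))\<^sup>2"
      using zero_le_power2[of "cmod (c i) - cmod (d i)"] by (simp add: power2_eq_square algebra_simps)
    finally show "norm ((cmod (c i - d i))\<^sup>2) \<le> 2 * (cmod (c i))\<^sup>2 + 2 * (cmod (d i))\<^sup>2" by simp
  qed
  then show ?thesis by (simp add: ell2_def)
qed

lemma ell2_inner_reindex: "bij \<sigma> \<Longrightarrow> ell2_inner (\<lambda>i. c (\<sigma> i)) (\<lambda>i. d (\<sigma> i)) = ell2_inner c d"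
  unfolding ell2_inner_def using infsum_reindex_bij_betw[of \<sigma> UNIV UNIV "\<lambda>i. c i * cnj (d i)"] by simp

lemma ell2_reindex: "bij \<sigma> \<Longrightarrow> c \<in> ell2 \<Longrightarrow> (\<lambda>i. c (\<sigma> i)) \<in> ell2"
  unfolding ell2_def
  using summable_on_reindex_bij_betw[of \<sigma> UNIV UNIV "\<lambda>i. (cmod (c i))\<^sup>2"] by simp

section \<open>Frames and the form of their frame operator\<close>

lemma is_frame_iff:
  "is_frame f \<longleftrightarrow> (\<exists>A B. 0 < A \<and> 0 < B \<and> (\<forall>x. analysis_op f x \<in> ell2 \<and>
     A * (norm x)\<^sup>2 \<le> ell2_norm_sq (analysis_op f x) \<and> ell2_norm_sq (analysis_op f x) \<le> B * (norm x)\<^sup>2))"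
  by (simp add: is_frame_def analysis_op_def ell2_def ell2_norm_sq_def)

lemma frame_analysis_op_ell2: "is_frame f \<Longrightarrow> analysis_op f x \<in> ell2"
  by (auto simp: is_frame_iff)

lemma analysis_op_add: "analysis_op f (x + y) = (\<lambda>i. analysis_op f x i + analysis_op f y i)"
  by (simp add: analysis_op_def cinner_add_left)

lemma analysis_op_scaleC: "analysis_op f (a *\<^sub>C x) = (\<lambda>i. a * analysis_op f x i)"
  by (simp add: analysis_op_def cinner_scaleC_left)

lemma analysis_op_scaleR: "analysis_op f (r *\<^sub>R x) = (\<lambda>i. complex_of_real r * analysis_op f x i)"
  by (simp add: scaleR_eq_scaleC analysis_op_scaleC)

lemma frame_analysis_op_injective:
  assumes "is_frame f" "analysis_op f x = analysis_op f y"
  shows "x = y"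
proof -
  obtain A where A: "0 < A" "A * (norm u)\<^sup>2 \<le> ell2_norm_sq (analysis_op f u)" for u
    using assms(1) by (auto simp: is_frame_iff)
  have "analysis_op f (x - y) = (\<lambda>_. 0)"
    using assms(2) by (simp add: analysis_op_def cinner_diff_left fun_eq_iff)
  then have "A * (norm (x - y))\<^sup>2 \<le> 0"
    using A(2)[of "x - y"] by (simp add: ell2_norm_sq_def)
  then show ?thesis using A(1) by (simp add: mult_le_0_iff)
qed

text \<open>
  The frame inequalities say that \<open>\<langle>\<Theta> x, \<Theta> y\<rangle>\<close> is a bounded coercive form, that is, that the frame
  operator is invertible. The real representation lemma applies to its real part; testing with
  \<open>\<i> x\<close> recovers the imaginary part.
\<close>

lemma frame_form_representation:
  fixes f :: "'i \<Rightarrow> 'a::complex_hilbert_space"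
  assumes f: "is_frame f" and \<phi>: "bounded_linear \<phi>" "\<And>c x. \<phi> (c *\<^sub>C x) = c * \<phi> x"
  shows "\<exists>z. \<forall>x. ell2_inner (analysis_op f x) (analysis_op f z) = \<phi> x"
proof -
  obtain A B where AB: "0 < A" "0 < B" "\<And>u. A * (norm u)\<^sup>2 \<le> ell2_norm_sq (analysis_op f u)"
    "\<And>u. ell2_norm_sq (analysis_op f u) \<le> B * (norm u)\<^sup>2"
    using f by (auto simp: is_frame_iff)
  note f2 = frame_analysis_op_ell2[OF f]
  let ?Q = "\<lambda>x y. Re (ell2_inner (analysis_op f x) (analysis_op f y))"
  have sym: "?Q x y = ?Q y x" for x y
    by (subst ell2_inner_commute) simp
  have add: "?Q (x + x') y = ?Q x y + ?Q x' y" for x x' y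
    by (simp add: analysis_op_add ell2_inner_add_left f2)
  have scale: "?Q (r *\<^sub>R x) y = r * ?Q x y" for r x y
    by (simp add: analysis_op_scaleR ell2_inner_scale_left)
  have "bounded_bilinear ?Q"
  proof
    fix x x' y y' r
    show "?Q (x + x') y = ?Q x y + ?Q x' y" "?Q x (y + y') = ?Q x y + ?Q x y'"
      "?Q (r *\<^sub>R x) y = r *\<^sub>R ?Q x y" "?Q x (r *\<^sub>R y) = r *\<^sub>R ?Q x y"
      by (simp_all add: add scale sym[of x])
    have "norm (?Q x y) \<le> norm x * norm y * B" for x y
    proof -
      have "norm (?Q x y) \<le> cmod (ell2_inner (analysis_op f x) (analysis_op f y))"
        by (simp add: abs_Re_le_cmod)
      also have "\<dots> \<le> (sqrt B * norm x) * (sqrt B * norm y)"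
        by (rule ell2_Cauchy_Schwarz) (use AB in \<open>simp_all add: f2 power_mult_distrib\<close>)
      also have "\<dots> = norm x * norm y * B"
        using AB(2) by (simp add: mult.commute mult.left_commute flip: power2_eq_square)
      finally show ?thesis .
    qed
    then show "\<exists>K. \<forall>x y. norm (?Q x y) \<le> norm x * norm y * K" by blast
  qed
  then have "\<exists>z. \<forall>x. ?Q x z = Re (\<phi> x)"
    by (rule symmetric_form_representation[OF _ sym AB(1)])
      (use AB in \<open>simp_all add: ell2_inner_self f2 bounded_linear_compose[OF bounded_linear_Re \<phi>(1)]\<close>)
  then obtain z where z: "?Q x z = Re (\<phi> x)" for x by blast
  have "ell2_inner (analysis_op f x) (analysis_op f z) = \<phi> x" for x
    using z[of x] z[of "\<i> *\<^sub>C x"]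
    by (simp add: complex_eq_iff analysis_op_scaleC ell2_inner_scale_left \<phi>(2))
  then show ?thesis by blast
qed

text \<open>
  The vector \<open>z\<close> is the inverse frame operator applied to \<open>u\<close>; for \<open>u\<close> in the frame it is the
  corresponding vector of the canonical dual frame.
\<close>

lemma frame_dual_vector:
  fixes f :: "'i \<Rightarrow> 'a::complex_hilbert_space"
  assumes f: "is_frame f"
  shows "\<exists>z. \<forall>x. ell2_inner (analysis_op f x) (analysis_op f z) = cinner x u"
proof (rule frame_form_representation[OF f])
  show "bounded_linear (\<lambda>x. cinner x u)"
  proof (rule bounded_linear_intro[where K = "2 * norm u"])
    fix x :: 'a
    have "norm (\<i> *\<^sub>C x) = norm x" by (rule norm_scaleC_ii)
    then have "\<bar>Re (cinner x u)\<bar> \<le> norm x * norm u" "\<bar>Im (cinner x u)\<bar> \<le> norm x * norm u"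
      using Cauchy_Schwarz_ineq2[of x u] Cauchy_Schwarz_ineq2[of "\<i> *\<^sub>C x" u]
      by (simp_all add: inner_eq_Re_cinner cinner_scaleC_left)
    then show "norm (cinner x u) \<le> norm x * (2 * norm u)"
      using cmod_le[of "cinner x u"] by (simp add: algebra_simps)
  qed (simp_all add: cinner_add_left cinner_scaleR_left)
qed (simp add: cinner_scaleC_left)

text \<open>
  The family \<open>\<Theta> z\<close> is the orthogonal projection of \<open>c\<close> onto the range of the analysis operator.
\<close>

lemma frame_projection:
  fixes f :: "'i \<Rightarrow> 'a::complex_hilbert_space"
  assumes f: "is_frame f" and c: "c \<in> ell2"
  shows "\<exists>z. \<forall>x. ell2_inner (analysis_op f x) (analysis_op f z) = ell2_inner (analysis_op f x) c"
proof (rule frame_form_representation[OF f])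
  obtain B where B: "0 < B" "\<And>u. ell2_norm_sq (analysis_op f u) \<le> B * (norm u)\<^sup>2"
    using f by (auto simp: is_frame_iff)
  note f2 = frame_analysis_op_ell2[OF f]
  show "bounded_linear (\<lambda>x. ell2_inner (analysis_op f x) c)"
  proof (rule bounded_linear_intro[where K = "sqrt B * sqrt (ell2_norm_sq c)"])
    show "norm (ell2_inner (analysis_op f x) c) \<le> norm x * (sqrt B * sqrt (ell2_norm_sq c))" for x
      using ell2_Cauchy_Schwarz[OF f2[of x] c, of "sqrt B * norm x" "sqrt (ell2_norm_sq c)"] B
      by (simp add: power_mult_distrib ell2_norm_sq_nonneg ac_simps)
  qed (simp_all add: analysis_op_add analysis_op_scaleR ell2_inner_add_left f2 c ell2_inner_scale_left
      scaleR_conv_of_real)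
qed (simp add: analysis_op_scaleC ell2_inner_scale_left)


section \<open>Invertible operators and frames\<close>

lemma invertible_op_iff_bij: "invertible_op A \<longleftrightarrow> bounded_clinear A \<and> bij A"
  for A :: "'a::complex_hilbert_space \<Rightarrow> 'a"
proof
  assume "invertible_op A"
  then show "bounded_clinear A \<and> bij A"
    unfolding invertible_op_def using o_bij by blast
next
  assume A: "bounded_clinear A \<and> bij A"
  then have inv: "A (inv A y) = y" "inv A (A x) = x" for x y
    by (simp_all add: bij_is_surj surj_f_inv_f bij_is_inj)
  have "bounded_linear (inv A)"
    using A bounded_linear_inv by (auto simp: bounded_clinear_def)
  moreover have "inv A (c *\<^sub>C y) = c *\<^sub>C inv A y" for c y
    using A inv by (metis bounded_clinear_def)
  ultimately have "bounded_clinear (inv A)" by (auto simp: bounded_clinear_def)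
  then show "invertible_op A"
    using A inv unfolding invertible_op_def by (auto simp: fun_eq_iff)
qed

lemma invertible_op_inv: "invertible_op A \<Longrightarrow> invertible_op (inv A)"
  for A :: "'a::complex_hilbert_space \<Rightarrow> 'a"
  unfolding invertible_op_def
  by (metis comp_id fun.map_comp inv_unique_comp)

text \<open>
  The coefficients of \<open>x\<close> in the family \<open>B f\<close> are those of \<open>B\<^sup>* x\<close> in \<open>f\<close>, and \<open>B\<^sup>*\<close> is bounded above and
  below.
\<close>

lemma is_frame_invertible_op:
  fixes f :: "'i \<Rightarrow> 'a::complex_hilbert_space"
  assumes f: "is_frame f" and B: "invertible_op B"
  shows "is_frame (\<lambda>i. B (f i))"
proof -
  obtain \<alpha> \<beta> where \<alpha>\<beta>: "0 < \<alpha>" "0 < \<beta>" "\<And>u. \<alpha> * (norm u)\<^sup>2 \<le> ell2_norm_sq (analysis_op f u)"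
    "\<And>u. ell2_norm_sq (analysis_op f u) \<le> \<beta> * (norm u)\<^sup>2"
    using f by (auto simp: is_frame_iff)
  obtain S where S: "bounded_clinear S" "B \<circ> S = id" and B': "bounded_clinear B"
    using B by (auto simp: invertible_op_def)
  have eq: "analysis_op (\<lambda>i. B (f i)) x = analysis_op f (adjoint B x)" for x
    by (simp add: analysis_op_def cinner_adjoint'[OF B'])
  have inverse: "adjoint S (adjoint B x) = x" for x
  proof (rule cinner_eqI)
    fix u
    show "cinner u (adjoint S (adjoint B x)) = cinner u x"
      using S(2) by (simp add: cinner_adjoint[OF S(1), symmetric] cinner_adjoint[OF B', symmetric]
          fun_eq_iff)
  qed
  obtain K where K: "0 < K" "norm (adjoint B x) \<le> norm x * K" for x
    using bounded_clinear_adjoint[OF B'] bounded_linear.pos_bounded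
    by (metis bounded_clinear_def)
  obtain K' where K': "0 < K'" "norm (adjoint S x) \<le> norm x * K'" for x
    using bounded_clinear_adjoint[OF S(1)] bounded_linear.pos_bounded
    by (metis bounded_clinear_def)
  show ?thesis
    unfolding is_frame_iff eq
  proof (intro exI conjI allI)
    show "0 < \<alpha> / K'\<^sup>2" "0 < \<beta> * K\<^sup>2" using \<alpha>\<beta> K(1) K'(1) by auto
    fix x
    show "analysis_op f (adjoint B x) \<in> ell2" by (rule frame_analysis_op_ell2[OF f])
    have "(norm x)\<^sup>2 \<le> (norm (adjoint B x) * K')\<^sup>2"
      using K'(2)[of "adjoint B x"] by (intro power_mono) (simp_all add: inverse)
    then have "\<alpha> * (norm x)\<^sup>2 \<le> \<alpha> * (norm (adjoint B x) * K')\<^sup>2"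
      using \<alpha>\<beta>(1) by (intro mult_left_mono) auto
    then have "\<alpha> / K'\<^sup>2 * (norm x)\<^sup>2 \<le> \<alpha> * (norm (adjoint B x))\<^sup>2"
      using K'(1) by (simp add: field_simps power_mult_distrib)
    also have "\<dots> \<le> ell2_norm_sq (analysis_op f (adjoint B x))" by (rule \<alpha>\<beta>)
    finally show "\<alpha> / K'\<^sup>2 * (norm x)\<^sup>2 \<le> ell2_norm_sq (analysis_op f (adjoint B x))" .
    have "ell2_norm_sq (analysis_op f (adjoint B x)) \<le> \<beta> * (norm (adjoint B x))\<^sup>2" by (rule \<alpha>\<beta>)
    also have "\<dots> \<le> \<beta> * (norm x * K)\<^sup>2"
      using K(2)[of x] \<alpha>\<beta>(2) by (intro mult_left_mono power_mono) auto
    finally show "ell2_norm_sq (analysis_op f (adjoint B x)) \<le> \<beta> * K\<^sup>2 * (norm x)\<^sup>2"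
      by (simp add: power_mult_distrib ac_simps)
  qed
qed

lemma frame_form_nondegenerate:
  assumes f: "is_frame f"
    and eq: "\<And>x. ell2_inner (analysis_op f x) (analysis_op f y) = ell2_inner (analysis_op f x) (analysis_op f z)"
  shows "y = z"
proof -
  have diff: "analysis_op f (y - z) = (\<lambda>i. analysis_op f y i - analysis_op f z i)"
    by (simp add: analysis_op_def cinner_diff_left)
  have "ell2_inner (analysis_op f (y - z)) (analysis_op f (y - z)) = 0"
    by (subst (2) diff) (simp add: ell2_inner_diff_right frame_analysis_op_ell2[OF f] eq)
  then have "ell2_norm_sq (analysis_op f (y - z)) = 0"
    by (simp add: ell2_inner_self frame_analysis_op_ell2[OF f])
  then have "analysis_op f (y - z) i = 0" for i
    by (rule ell2_norm_sq_eq_0D[OF frame_analysis_op_ell2[OF f]])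
  then show ?thesis
    by (intro frame_analysis_op_injective[OF f]) (simp add: diff fun_eq_iff)
qed

section \<open>Frames that are orbits of an abelian group\<close>

text \<open>
  A representation of an abelian group by bounded, not necessarily unitary, operators. For the
  theorem the group is \<open>\<int> \<times> \<int>\<close>, acting by \<open>T\<^sup>k L\<^sup>j\<close>.
\<close>

locale bounded_representation =
  fixes \<pi> :: "'g::ab_group_add \<Rightarrow> 'h::complex_hilbert_space \<Rightarrow> 'h"
  assumes bounded: "bounded_clinear (\<pi> g)"
    and zero: "\<pi> 0 x = x"
    and add: "\<pi> (g + h) x = \<pi> g (\<pi> h x)"
begin

abbreviation orbit :: "'h \<Rightarrow> 'g \<Rightarrow> 'h"
  where "orbit w \<equiv> (\<lambda>g. \<pi> g w)"

text \<open>
  The adjoints of \<open>\<pi>\<close> act on coefficient families as translations, which preserve the inner product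
  of families. Hence the frame operator intertwines \<open>\<pi>(- l)\<^sup>*\<close> with \<open>\<pi>(l)\<close>, and the vectors
  it sends to the orbit of \<open>u\<close> form an orbit of the contragredient representation.
\<close>

lemma dual_orbit_equivariant:
  assumes f: "is_frame (orbit w)"
    and d: "\<And>g x. ell2_inner (analysis_op (orbit w) x) (analysis_op (orbit w) (d g)) = cinner x (\<pi> g u)"
  shows "adjoint (\<pi> l) (d (g + l)) = d g"
proof (rule frame_form_nondegenerate[OF f])
  fix x
  let ?\<Theta> = "analysis_op (orbit w)"
  define x' where "x' = adjoint (\<pi> (- l)) x"
  have x': "x = adjoint (\<pi> l) x'"
  proof (rule cinner_eqI)
    fix y
    show "cinner y x = cinner y (adjoint (\<pi> l) x')"
      by (simp add: x'_def zero flip: cinner_adjoint[OF bounded] add)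
  qed
  have shift: "?\<Theta> (adjoint (\<pi> l) y) = (\<lambda>h. ?\<Theta> y (l + h))" for y
    by (simp add: analysis_op_def cinner_adjoint'[OF bounded] add)
  have "ell2_inner (?\<Theta> x) (?\<Theta> (adjoint (\<pi> l) (d (g + l)))) = ell2_inner (?\<Theta> x') (?\<Theta> (d (g + l)))"
    unfolding x' shift by (rule ell2_inner_reindex) (simp add: bij_def)
  also have "\<dots> = cinner x (\<pi> (- l) (\<pi> (g + l) u))"
    by (simp add: d x'_def cinner_adjoint'[OF bounded])
  also have "\<dots> = ell2_inner (?\<Theta> x) (?\<Theta> (d g))"
    by (simp add: d flip: add)
  finally show "ell2_inner (?\<Theta> x) (?\<Theta> (adjoint (\<pi> l) (d (g + l)))) = ell2_inner (?\<Theta> x) (?\<Theta> (d g))" .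
qed

text \<open>
  Equivariance is recorded as invariance of the matrix entries \<open>\<langle>d g, \<pi>(h) y\<rangle>\<close> under simultaneous
  translation of \<open>g\<close> and \<open>h\<close>; such matrices are convolution kernels.
\<close>

lemma dual_orbit_exists:
  assumes f: "is_frame (orbit w)"
  obtains d where
    "\<And>g x. ell2_inner (analysis_op (orbit w) x) (analysis_op (orbit w) (d g)) = cinner x (\<pi> g u)"
    "\<And>g l h y. cinner (d (g + l)) (\<pi> (h + l) y) = cinner (d g) (\<pi> h y)"
proof -
  have "\<exists>d. \<forall>g x. ell2_inner (analysis_op (orbit w) x) (analysis_op (orbit w) (d g)) = cinner x (\<pi> g u)"
    using frame_dual_vector[OF f, of "\<pi> _ u"] by metis
  then obtain d where d:
    "\<And>g x. ell2_inner (analysis_op (orbit w) x) (analysis_op (orbit w) (d g)) = cinner x (\<pi> g u)"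
    by blast
  moreover have "cinner (d (g + l)) (\<pi> (h + l) y) = cinner (d g) (\<pi> h y)" for g l h y
    by (simp add: add.commute[of h] add cinner_adjoint'[OF bounded, symmetric]
        dual_orbit_equivariant[OF f d])
  ultimately show ?thesis using that by blast
qed

text \<open>
  Commutativity of the group is decisive here. The orthogonal projection onto the
  range of \<open>\<Theta>\<close> has matrix \<open>\<langle>d g, \<pi>(h) w\<rangle>\<close> with \<open>d\<close> the canonical dual frame. This matrix is
  Hermitian and, by equivariance, depends only on the difference of the two indices; in an abelian
  group it is therefore invariant under conjugation combined with negation of both indices
  (\<open>herm\<close> below). So the projection commutes with the conjugate-linear reflection
  \<open>c\<^sub>g \<mapsto> cnj c\<^sub>-\<^sub>g\<close>, and its range is invariant.
\<close>

lemma range_analysis_op_reflect: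
  assumes f: "is_frame (orbit w)"
  shows "\<exists>z. \<forall>g. cinner z (\<pi> g w) = cnj (cinner x (\<pi> (- g) w))"
proof -
  let ?\<Theta> = "analysis_op (orbit w)"
  obtain d where d: "\<And>g x. ell2_inner (?\<Theta> x) (?\<Theta> (d g)) = cinner x (\<pi> g w)"
    and equiv: "\<And>g l h y. cinner (d (g + l)) (\<pi> (h + l) y) = cinner (d g) (\<pi> h y)"
    using dual_orbit_exists[OF f, of w] by metis
  define c where "c g = cnj (?\<Theta> x (- g))" for g
  have "c \<in> ell2"
    using ell2_reindex[OF bij_uminus frame_analysis_op_ell2[OF f, of x]] by (simp add: c_def ell2_def)
  then obtain z where z: "\<And>y. ell2_inner (?\<Theta> y) (?\<Theta> z) = ell2_inner (?\<Theta> y) c"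
    using frame_projection[OF f] by blast
  have herm: "?\<Theta> (d k) h = cnj (?\<Theta> (d (- k)) (- h))" for k h
  proof -
    have "?\<Theta> (d k) h = cinner (d (- h)) (\<pi> (- k) w)"
      using equiv[of k "- h - k" h w] by (simp add: analysis_op_def)
    also have "\<dots> = cnj (cinner (d (- k)) (\<pi> (- h) w))"
      by (metis d ell2_inner_commute)
    finally show ?thesis by (simp add: analysis_op_def)
  qed
  have "cinner z (\<pi> k w) = cnj (cinner x (\<pi> (- k) w))" for k
  proof -
    have "cinner z (\<pi> k w) = cnj (ell2_inner (?\<Theta> (d k)) c)"
      by (metis d z ell2_inner_commute)
    also have "ell2_inner (?\<Theta> (d k)) c = ell2_inner (\<lambda>h. ?\<Theta> x (- h)) (\<lambda>h. ?\<Theta> (d (- k)) (- h))"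
      unfolding ell2_inner_def herm[of k] by (simp add: c_def mult.commute)
    also have "\<dots> = cinner x (\<pi> (- k) w)"
      by (subst ell2_inner_reindex[OF bij_uminus]) (rule d)
    finally show ?thesis .
  qed
  then show ?thesis by blast
qed

text \<open>
  Let \<open>t\<close> be the vector whose coefficients in the orbit of \<open>v\<close> are the projection of \<open>e\<close>. The
  vectors \<open>y g\<close> that the frame operator of \<open>v\<close> sends to \<open>\<pi>(g) w\<close> satisfy
  \<open>\<langle>t, \<pi>(g) w\<rangle> = cnj \<langle>\<Theta>\<^sub>v (y g), e\<rangle>\<close>. But the coefficients of \<open>y g\<close> are the
  reflection of coefficients in the orbit of \<open>w\<close>, so they lie in the range of \<open>\<Theta>\<^sub>w\<close>, to
  which \<open>e\<close> is orthogonal. Hence \<open>t = 0\<close>, and with it the projection of \<open>e\<close>.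
\<close>

lemma orthogonal_complement_mono:
  assumes v: "is_frame (orbit v)" and w: "is_frame (orbit w)" and e: "e \<in> ell2"
    and orth: "\<And>x. ell2_inner (analysis_op (orbit w) x) e = 0"
  shows "ell2_inner (analysis_op (orbit v) x) e = 0"
proof -
  let ?V = "analysis_op (orbit v)" and ?W = "analysis_op (orbit w)"
  obtain d where d: "\<And>g x. ell2_inner (?V x) (?V (d g)) = cinner x (\<pi> g v)"
    and equiv: "\<And>g l h y. cinner (d (g + l)) (\<pi> (h + l) y) = cinner (d g) (\<pi> h y)"
    using dual_orbit_exists[OF v, of v] by metis
  obtain y where y: "\<And>g x. ell2_inner (?V x) (?V (y g)) = cinner x (\<pi> g w)"
    using dual_orbit_exists[OF v, of w] by metis
  obtain t where t: "\<And>x. ell2_inner (?V x) (?V t) = ell2_inner (?V x) e"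
    using frame_projection[OF v e] by blast
  have "cinner t (\<pi> g w) = 0" for g
  proof -
    obtain z where z: "\<And>h. cinner z (\<pi> h w) = cnj (cinner (d (- g)) (\<pi> (- h) w))"
      using range_analysis_op_reflect[OF w] by blast
    have "?V (y g) = ?W z"
    proof
      fix h
      have "?V (y g) h = cnj (cinner (d h) (\<pi> g w))"
        by (metis analysis_op_def d y ell2_inner_commute)
      also have "cinner (d h) (\<pi> g w) = cinner (d (- g)) (\<pi> (- h) w)"
        using equiv[of h "- g - h" g w] by simp
      finally show "?V (y g) h = ?W z h" by (simp add: z analysis_op_def)
    qed
    then have "ell2_inner (?V (y g)) (?V t) = 0"
      using t[of "y g"] orth[of z] by simp
    then show ?thesis
      by (metis y ell2_inner_commute complex_cnj_zero)
  qed
  then have "?W t = ?W 0" by (simp add: analysis_op_def)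
  then have "t = 0" by (rule frame_analysis_op_injective[OF w])
  then show ?thesis
    using t[of x] by (simp add: analysis_op_def ell2_inner_def)
qed

text \<open>
  The part \<open>e\<close> of \<open>\<Theta>\<^sub>v x\<close> orthogonal to the range of \<open>\<Theta>\<^sub>w\<close> is also orthogonal to the range
  of \<open>\<Theta>\<^sub>v\<close>, hence to itself.
\<close>

lemma range_analysis_op_subset:
  assumes v: "is_frame (orbit v)" and w: "is_frame (orbit w)"
  shows "\<exists>z. analysis_op (orbit w) z = analysis_op (orbit v) x"
proof -
  let ?V = "analysis_op (orbit v)" and ?W = "analysis_op (orbit w)"
  note v2 = frame_analysis_op_ell2[OF v] and w2 = frame_analysis_op_ell2[OF w]
  obtain z where z: "\<And>y. ell2_inner (?W y) (?W z) = ell2_inner (?W y) (?V x)"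
    using frame_projection[OF w v2] by blast
  define e where "e = (\<lambda>g. ?V x g - ?W z g)"
  have e2: "e \<in> ell2" unfolding e_def by (rule ell2_diff[OF v2 w2])
  have W: "ell2_inner (?W y) e = 0" for y
    unfolding e_def by (simp add: ell2_inner_diff_right v2 w2 z)
  have V: "ell2_inner (?V y) e = 0" for y
    by (rule orthogonal_complement_mono[OF v w e2 W])
  have "ell2_inner e e = 0"
    using ell2_inner_diff_right[OF e2 v2[of x] w2[of z], folded e_def]
    by (simp add: ell2_inner_commute[of e "?V x"] ell2_inner_commute[of e "?W z"] V W)
  then have "e g = 0" for g
    using ell2_norm_sq_eq_0D[OF e2] by (simp add: ell2_inner_self[OF e2])
  then show ?thesis by (auto simp: e_def fun_eq_iff)
qed

text \<open>
  This is \<open>C = \<Theta>\<^sub>w\<^sup>-\<^sup>1 \<Theta>\<^sub>v\<close>, defined everywhere because the ranges are nested.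
\<close>

lemma transfer_operator:
  assumes v: "is_frame (orbit v)" and w: "is_frame (orbit w)"
  obtains C where "bounded_clinear C" "\<And>x g. cinner (C x) (\<pi> g w) = cinner x (\<pi> g v)"
proof -
  let ?V = "analysis_op (orbit v)" and ?W = "analysis_op (orbit w)"
  obtain C where C: "\<And>x. ?W (C x) = ?V x"
    using range_analysis_op_subset[OF v w] by metis
  note inj = frame_analysis_op_injective[OF w]
  obtain \<beta> where \<beta>: "0 < \<beta>" "\<And>u. ell2_norm_sq (?V u) \<le> \<beta> * (norm u)\<^sup>2"
    using v by (auto simp: is_frame_iff)
  obtain \<alpha> where \<alpha>: "0 < \<alpha>" "\<And>u. \<alpha> * (norm u)\<^sup>2 \<le> ell2_norm_sq (?W u)"
    using w by (auto simp: is_frame_iff)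
  have scaleC: "C (c *\<^sub>C x) = c *\<^sub>C C x" for c x
    by (rule inj) (simp add: C analysis_op_scaleC)
  have "bounded_linear C"
  proof (rule bounded_linear_intro[where K = "sqrt (\<beta> / \<alpha>)"])
    show "C (x + y) = C x + C y" for x y
      by (rule inj) (simp add: C analysis_op_add)
    show "C (r *\<^sub>R x) = r *\<^sub>R C x" for r x
      by (simp add: scaleR_eq_scaleC scaleC)
    show "norm (C x) \<le> norm x * sqrt (\<beta> / \<alpha>)" for x
    proof (rule power2_le_imp_le)
      have "\<alpha> * (norm (C x))\<^sup>2 \<le> \<beta> * (norm x)\<^sup>2"
        using \<alpha>(2)[of "C x"] \<beta>(2)[of x] by (simp add: C)
      then show "(norm (C x))\<^sup>2 \<le> (norm x * sqrt (\<beta> / \<alpha>))\<^sup>2"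
        using \<alpha>(1) \<beta>(1) by (simp add: power_mult_distrib field_simps)
    qed (use \<alpha> \<beta> in simp)
  qed
  then have "bounded_clinear C" by (simp add: bounded_clinear_def scaleC)
  moreover have "cinner (C x) (\<pi> g w) = cinner x (\<pi> g v)" for x g
    using fun_cong[OF C[of x], of g] by (simp add: analysis_op_def)
  ultimately show ?thesis using that by blast
qed

text \<open>
  The operator is the adjoint of \<open>\<Theta>\<^sub>w\<^sup>-\<^sup>1 \<Theta>\<^sub>v\<close>; its inverse comes from exchanging the roles of
  \<open>v\<close> and \<open>w\<close>.
\<close>

theorem frame_generators_equivalent:
  assumes v: "is_frame (orbit v)" and w: "is_frame (orbit w)"
  obtains B where "invertible_op B" "B w = v" "\<And>g. B \<circ> \<pi> g = \<pi> g \<circ> B"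
proof -
  obtain C where C: "bounded_clinear C" "\<And>x g. cinner (C x) (\<pi> g w) = cinner x (\<pi> g v)"
    using transfer_operator[OF v w] by metis
  obtain C' where C': "bounded_clinear C'" "\<And>x g. cinner (C' x) (\<pi> g v) = cinner x (\<pi> g w)"
    using transfer_operator[OF w v] by metis
  have eqI: "x = y" if "\<And>g. cinner x (\<pi> g w) = cinner y (\<pi> g w)" for x y
    by (rule frame_analysis_op_injective[OF w]) (simp add: analysis_op_def that)
  have eqI': "x = y" if "\<And>g. cinner x (\<pi> g v) = cinner y (\<pi> g v)" for x y
    by (rule frame_analysis_op_injective[OF v]) (simp add: analysis_op_def that)
  have inverse: "C (C' x) = x" "C' (C x) = x" for x
    by (rule eqI, simp add: C C') (rule eqI', simp add: C C')
  have comm: "C (adjoint (\<pi> h) x) = adjoint (\<pi> h) (C x)" for h x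
    by (rule eqI) (simp add: C(2) cinner_adjoint'[OF bounded] flip: add)
  note adj = cinner_adjoint[OF C(1), symmetric] cinner_adjoint[OF C'(1), symmetric]
  show ?thesis
  proof (rule that[of "adjoint C"])
    have "adjoint C' (adjoint C x) = x" "adjoint C (adjoint C' x) = x" for x
      by (rule cinner_eqI, simp add: adj inverse)+
    then show "invertible_op (adjoint C)"
      unfolding invertible_op_def
      by (auto simp: fun_eq_iff bounded_clinear_adjoint C C' intro!: exI[of _ "adjoint C'"])
    show "adjoint C w = v"
      by (rule cinner_eqI) (use C(2)[of _ 0] in \<open>simp add: adj zero\<close>)
    show "adjoint C \<circ> \<pi> g = \<pi> g \<circ> adjoint C" for g
    proof
      fix x
      show "(adjoint C \<circ> \<pi> g) x = (\<pi> g \<circ> adjoint C) x"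
        by (rule cinner_eqI)
          (metis adj(1) bounded cinner_adjoint' comm comp_apply)
    qed
  qed
qed

end

section \<open>Integer powers of invertible operators\<close>

lemma int_funpow_succ: "int_funpow A (1 + k) x = A (int_funpow A k x)" if "bij A"
proof (cases k rule: int_cases)
  case (nonneg n)
  then show ?thesis by (simp add: int_funpow_def nat_add_distrib)
next
  case (neg n)
  then show ?thesis using that
    by (auto simp: int_funpow_def bij_is_surj surj_f_inv_f nat_add_distrib)
qed

lemma int_funpow_pred: "int_funpow A (k - 1) x = inv A (int_funpow A k x)" if "bij A"
  using int_funpow_succ[OF that, of "k - 1" x] that by (simp add: bij_is_inj)

lemma int_funpow_0 [simp]: "int_funpow A 0 x = x"
  by (simp add: int_funpow_def)

lemma int_funpow_add: "int_funpow A (k + l) x = int_funpow A k (int_funpow A l x)" if "bij A"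
proof (induction k rule: int_induct[where k = 0])
  case (step1 i)
  then show ?case using int_funpow_succ[OF that] by (metis add.assoc add.commute)
next
  case (step2 i)
  then show ?case using int_funpow_pred[OF that] by (metis diff_add_eq)
qed simp

lemma int_funpow_commute:
  assumes "bij A" and "X \<circ> A = A \<circ> X"
  shows "X (int_funpow A k x) = int_funpow A k (X x)"
proof (induction k rule: int_induct[where k = 0])
  case (step1 i)
  then show ?case using int_funpow_succ[OF assms(1)] assms(2)
    by (metis add.commute comp_apply)
next
  case (step2 i)
  then show ?case using int_funpow_pred[OF assms(1)] assms
    by (metis bij_inv_eq_iff comp_apply)
qed simp

lemma bounded_clinear_int_funpow:
  fixes A :: "'a::complex_hilbert_space \<Rightarrow> 'a"
  assumes A: "invertible_op A"
  shows "bounded_clinear (int_funpow A k)"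
proof -
  have comp: "bounded_clinear (F \<circ> G)" if "bounded_clinear F" "bounded_clinear G" for F G :: "'a \<Rightarrow> 'a"
    using that by (auto simp: bounded_clinear_def comp_def intro: bounded_linear_compose)
  have pow: "bounded_clinear (F ^^ n)" if "bounded_clinear F" for n and F :: "'a \<Rightarrow> 'a"
  proof (induction n)
    case 0
    show ?case by (simp add: bounded_clinear_def id_def)
  next
    case (Suc n)
    then show ?case using comp[OF that Suc.IH] by (simp add: comp_def)
  qed
  show ?thesis
    using A invertible_op_inv[OF A] by (auto simp: int_funpow_def invertible_op_def pow)
qed

section \<open>Generators of bilateral frames\<close>

theorem theorem4p7:
  fixes T L :: "'h::complex_hilbert_space \<Rightarrow> 'h" and w :: 'h
  assumes separable: "\<exists>D :: 'h set. countable D \<and> closure D = UNIV"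
    and T: "invertible_op T" and L: "invertible_op L" and comm: "L \<circ> T = T \<circ> L"
    and w: "w \<in> frame_vectors T L"
  shows "(\<forall>v. v \<in> frame_vectors T L \<longleftrightarrow> similar_tuples T L v T L w) \<and>
    frame_vectors T L = {B w | B. invertible_op B \<and> B \<circ> T = T \<circ> B \<and> B \<circ> L = L \<circ> B}"
proof -
  have bij: "bij T" "bij L"
    using T L by (simp_all add: invertible_op_iff_bij)
  define \<pi> where "\<pi> = (\<lambda>(k, j) x. int_funpow T k (int_funpow L j x))"
  have frame_iff: "v \<in> frame_vectors T L \<longleftrightarrow> is_frame (\<lambda>g. \<pi> g v)" for v
    using T L comm by (simp add: frame_vectors_def bilateral_frame_tuple_def \<pi>_def case_prod_beta')
  interpret bounded_representation \<pi>
  proof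
    show "bounded_clinear (\<pi> g)" for g
      using bounded_clinear_int_funpow[OF T, of "fst g"] bounded_clinear_int_funpow[OF L, of "snd g"]
      by (auto simp: \<pi>_def case_prod_beta bounded_clinear_def intro: bounded_linear_compose)
    show "\<pi> 0 x = x" for x by (simp add: \<pi>_def case_prod_beta)
    have LT: "int_funpow L j (int_funpow T k x) = int_funpow T k (int_funpow L j x)" for j k x
    proof (rule int_funpow_commute[OF bij(1)])
      show "int_funpow L j \<circ> T = T \<circ> int_funpow L j"
        using int_funpow_commute[OF bij(2) comm[symmetric]] by (simp add: fun_eq_iff)
    qed
    show "\<pi> (g + h) x = \<pi> g (\<pi> h x)" for g h x
      by (simp add: \<pi>_def case_prod_beta int_funpow_add bij LT)
  qed
  have T_eq: "\<pi> (1, 0) = T" and L_eq: "\<pi> (0, 1) = L"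
    by (simp_all add: \<pi>_def int_funpow_def fun_eq_iff)
  have frame: "v \<in> frame_vectors T L \<longleftrightarrow>
      (\<exists>B. v = B w \<and> invertible_op B \<and> B \<circ> T = T \<circ> B \<and> B \<circ> L = L \<circ> B)" for v
  proof
    assume "v \<in> frame_vectors T L"
    with w obtain B where "invertible_op B" "B w = v" "\<And>g. B \<circ> \<pi> g = \<pi> g \<circ> B"
      using frame_generators_equivalent unfolding frame_iff by metis
    then show "\<exists>B. v = B w \<and> invertible_op B \<and> B \<circ> T = T \<circ> B \<and> B \<circ> L = L \<circ> B"
      using T_eq L_eq by metis
  next
    assume "\<exists>B. v = B w \<and> invertible_op B \<and> B \<circ> T = T \<circ> B \<and> B \<circ> L = L \<circ> B"
    then obtain B where B: "v = B w" "invertible_op B" "B \<circ> T = T \<circ> B" "B \<circ> L = L \<circ> B" by blast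
    have "(\<lambda>g. \<pi> g v) = (\<lambda>g. B (\<pi> g w))"
      by (simp add: \<pi>_def case_prod_beta B(1) int_funpow_commute[OF bij(1) B(3)]
          int_funpow_commute[OF bij(2) B(4)])
    then show "v \<in> frame_vectors T L"
      using is_frame_invertible_op[OF w[unfolded frame_iff] B(2)] by (simp add: frame_iff)
  qed
  have similar: "similar_tuples T L v T L w \<longleftrightarrow>
      (\<exists>B. v = B w \<and> invertible_op B \<and> B \<circ> T = T \<circ> B \<and> B \<circ> L = L \<circ> B)" for v
  proof -
    have inv_comm: "inv C \<circ> A = A \<circ> inv C" if "bij C" "C \<circ> A = A \<circ> C" for C A :: "'h \<Rightarrow> 'h"
      using that by (metis bij_inv_eq_iff comp_apply ext)
    show ?thesis
    proof
      assume "similar_tuples T L v T L w"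
      then obtain C where C: "invertible_op C" "bij C" "C v = w" "T \<circ> C = C \<circ> T" "L \<circ> C = C \<circ> L"
        by (auto simp: similar_tuples_def invertible_op_iff_bij)
      then have "v = inv C w" by (metis bij_inv_eq_iff)
      then show "\<exists>B. v = B w \<and> invertible_op B \<and> B \<circ> T = T \<circ> B \<and> B \<circ> L = L \<circ> B"
        using C inv_comm[OF C(2)] invertible_op_inv[OF C(1)] by metis
    next
      assume "\<exists>B. v = B w \<and> invertible_op B \<and> B \<circ> T = T \<circ> B \<and> B \<circ> L = L \<circ> B"
      then obtain B where B: "v = B w" "invertible_op B" "B \<circ> T = T \<circ> B" "B \<circ> L = L \<circ> B" by blast
      have bijB: "bij B" using B(2) by (simp add: invertible_op_iff_bij)
      have "bounded_clinear (inv B) \<and> bij (inv B)"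
        using invertible_op_inv[OF B(2)] by (simp add: invertible_op_iff_bij)
      moreover have "inv B v = w" using bijB by (simp add: B(1) bij_is_inj)
      ultimately show "similar_tuples T L v T L w"
        unfolding similar_tuples_def using inv_comm[OF bijB B(3)] inv_comm[OF bijB B(4)]
        by (intro exI[of _ "inv B"]) simp
    qed
  qed
  show ?thesis
    using frame similar by blast
qed

end
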